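(* Let $f,g_1,\ldots,g_m\in\mathbb{R}[\mathbf{x}]$, and let $d=\max\{\lceil\deg(f)/2\rceil,d_1,\ldots,d_m\}$ with $d_j=\lceil\deg(g_j)/2\rceil$. For fixed $k\ge1$, the sequence $(\theta^{(k)}_{\hat d})_{\hat d\ge d}$ of optimal values of the block moment relaxations $(\mathrm{Q}^k_{\hat d})$ is monotone nondecreasing (in $\hat d$).
   Context: $\mathbb{N}=\{0,1,2,\ldots\}$; $\mathbb{R}[\mathbf{x}]=\mathbb{R}[x_1,\ldots,x_n]$; $\mathbb{N}^n_t=\{\alpha\in\mathbb{N}^n:\sum_i\alpha_i\le t\}$; $\mathrm{supp}(h)$ is the set of exponents with nonzero coefficient in $h$; sums of sets are Minkowski sums. The setting is the problem of minimizing $f$ over $\mathbf{K}=\{\mathbf{x}\in\mathbb{R}^n:g_j(\mathbf{x})\ge0,\ j=1,\ldots,m\}$. Put $g_0=1$, $d_0=0$. For a real sequence $\mathbf{y}=(y_\alpha)_{\alpha\in\mathbb{N}^n}$, $L_{\mathbf{y}}(\sum_\alpha h_\alpha\mathbf{x}^\alpha)=\sum_\alpha h_\alpha y_\alpha$; for $g=\sum_\alpha g_\alpha\mathbf{x}^\alpha$ the localizing matrix $M_t(g\mathbf{y})$ is indexed by $\mathbb{N}^n_t$ with entries $M_t(g\mathbf{y})_{\beta\gamma}=\sum_\alpha g_\alpha y_{\alpha+\beta+\gamma}$, and $M_t(\mathbf{y})=M_t(1\cdot\mathbf{y})$ is the moment matrix. $\succeq0$ means positive semidefinite, $\circ$ is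 the entrywise product. Block-closure: for a symmetric binary ($\{0,1\}$-valued) matrix $B$, $\overline{B}$ is the binary matrix whose set of positions of nonzero entries is the transitive closure of the relation $\{(i,j):B_{ij}=1\}$. Iteration (for each $\hat d\ge d$): let $\mathcal{A}=\mathrm{supp}(f)\cup\bigcup_{j=1}^m\mathrm{supp}(g_j)$, $\mathcal{S}^{(0)}_{0,\hat d}=\mathcal{A}\cup(2\mathbb{N})^n$, $\mathcal{S}^{(0)}_{j,\hat d}=\emptyset$ for $j=1,\ldots,m$. For $k\ge1$ and $j=0,\ldots,m$ define binary matrices indexed by $\mathbb{N}^n_{\hat d-d_j}$: (1) $[C^{(k)}_{j,\hat d}]_{\beta\gamma}=1$ if $(\mathrm{supp}(g_j)+\beta+\gamma)\cap\bigcup_{i=0}^m\mathcal{S}^{(k-1)}_{i,\hat d}\ne\emptyset$, and $0$ otherwise; (2) $B^{(k)}_{j,\hat d}=\overline{C^{(k)}_{j,\hat d}}$ and $\mathcal{S}^{(k)}_{j,\hat d}=\mathrm{supp}(g_j)+\{\beta+\gamma:[B^{(k)}_{j,\hat d}]_{\beta\gamma}=1\}$. Block relaxation $(\mathrm{Q}^k_{\hat d})$: minimize $L_{\mathbf{y}}(f)$ subject to $B^{(k)}_{0,\hat d}\circ M_{\hat d}(\mathbf{y})\succeq0$, $B^{(k)}_{j,\hat d}\circ M_{\hat d-d_j}(g_j\mathbf{y})\succeq0$ for $j=1,\ldots,m$, $y_{\mathbf{0}}=1$; its optimal value (infimum, in $\mathbb{R}\cup\{\pm\infty\}$) is $\theta^{(k)}_{\hat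 d}$. *)

theory Defs
  imports
    Complex_Main
    "HOL-Library.Poly_Mapping"
    "HOL-Library.Set_Algebras"
    "HOL-Library.Extended_Real"
begin

text \<open>
  The \<open>n\<close> variables are indexed by a finite type \<open>'n\<close> with \<open>CARD('n) = n\<close>. Exponent vectors are
  the maps from \<open>'n\<close> to the naturals, and a real polynomial is the finitely supported map sending
  an exponent to its coefficient.
\<close>

type_synonym 'n expo = "'n \<Rightarrow>\<^sub>0 nat"
type_synonym 'n rpoly = "'n expo \<Rightarrow>\<^sub>0 real"

definition supp :: "'n rpoly \<Rightarrow> 'n expo set" where
  "supp h = Poly_Mapping.keys h"

definition expo_deg :: "'n::finite expo \<Rightarrow> nat" where
  "expo_deg \<alpha> = (\<Sum>i\<in>UNIV. Poly_Mapping.lookup \<alpha> i)"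

definition expos_upto :: "nat \<Rightarrow> 'n::finite expo set" where
  "expos_upto t = {\<alpha>. expo_deg \<alpha> \<le> t}"

text \<open>The zero polynomial gets degree \<open>0\<close>.\<close>

definition poly_deg :: "'n::finite rpoly \<Rightarrow> nat" where
  "poly_deg h = Max (insert 0 (expo_deg ` supp h))"

definition half_deg :: "'n::finite rpoly \<Rightarrow> nat" where
  "half_deg h = nat \<lceil>real (poly_deg h) / 2\<rceil>"

text \<open>The constraint polynomials are \<open>g 1, \<dots>, g m\<close>; the value \<open>g 0\<close> is ignored, as \<open>g\<^sub>0 = 1\<close>.\<close>

definition constr :: "(nat \<Rightarrow> 'n rpoly) \<Rightarrow> nat \<Rightarrow> 'n rpoly" where
  "constr g j = (if j = 0 then 1 else g j)"

definition constr_half_deg :: "(nat \<Rightarrow> 'n::finite rpoly) \<Rightarrow> nat \<Rightarrow> nat" where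
  "constr_half_deg g j = (if j = 0 then 0 else half_deg (g j))"

definition min_order :: "'n::finite rpoly \<Rightarrow> (nat \<Rightarrow> 'n rpoly) \<Rightarrow> nat \<Rightarrow> nat" where
  "min_order f g m = Max (insert (half_deg f) (constr_half_deg g ` {1..m}))"

definition riesz :: "('n expo \<Rightarrow> real) \<Rightarrow> 'n rpoly \<Rightarrow> real" where
  "riesz y h = (\<Sum>\<alpha>\<in>supp h. Poly_Mapping.lookup h \<alpha> * y \<alpha>)"

text \<open>
  A matrix indexed by a set \<open>I\<close> is a two-argument function together with \<open>I\<close>; its values outside
  \<open>I \<times> I\<close> are irrelevant. All index sets used are of the form \<^term>\<open>expos_upto t\<close>, hence finite.
\<close>

definition localizing_mat ::
  "'n rpoly \<Rightarrow> ('n expo \<Rightarrow> real) \<Rightarrow> 'n expo \<Rightarrow> 'n expo \<Rightarrow> real" where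
  "localizing_mat h y \<beta> \<gamma> = (\<Sum>\<alpha>\<in>supp h. Poly_Mapping.lookup h \<alpha> * y (\<alpha> + \<beta> + \<gamma>))"

definition psd_mat :: "'i set \<Rightarrow> ('i \<Rightarrow> 'i \<Rightarrow> real) \<Rightarrow> bool" where
  "psd_mat I M \<longleftrightarrow>
     (\<forall>i\<in>I. \<forall>j\<in>I. M i j = M j i) \<and>
     (\<forall>v :: 'i \<Rightarrow> real. 0 \<le> (\<Sum>i\<in>I. \<Sum>j\<in>I. v i * M i j * v j))"

definition hadamard :: "('i \<Rightarrow> 'i \<Rightarrow> real) \<Rightarrow> ('i \<Rightarrow> 'i \<Rightarrow> real) \<Rightarrow> 'i \<Rightarrow> 'i \<Rightarrow> real" where
  "hadamard A B i j = A i j * B i j"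

text \<open>The closure is transitive only: an index with an all-zero row keeps a zero diagonal entry.\<close>

definition block_closure :: "'i set \<Rightarrow> ('i \<Rightarrow> 'i \<Rightarrow> real) \<Rightarrow> 'i \<Rightarrow> 'i \<Rightarrow> real" where
  "block_closure I B i j = of_bool ((i, j) \<in> {(i, j). i \<in> I \<and> j \<in> I \<and> B i j = 1}\<^sup>+)"

text \<open>Throughout, \<open>s\<close> is the relaxation order.\<close>

definition idx :: "(nat \<Rightarrow> 'n::finite rpoly) \<Rightarrow> nat \<Rightarrow> nat \<Rightarrow> 'n expo set" where
  "idx g s j = expos_upto (s - constr_half_deg g j)"

definition supp_all :: "'n rpoly \<Rightarrow> (nat \<Rightarrow> 'n rpoly) \<Rightarrow> nat \<Rightarrow> 'n expo set" where
  "supp_all f g m = supp f \<union> (\<Union>j\<in>{1..m}. supp (g j))"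

definition even_expos :: "'n expo set" where
  "even_expos = {\<alpha>. \<forall>i. even (Poly_Mapping.lookup \<alpha> i)}"

text \<open>
  One round of the iteration. Here \<open>T\<close> stands for the union over \<open>i = 0, \<dots>, m\<close> of the sets
  \<open>S\<^sub>i\<close> of the previous round.
\<close>

definition C_step :: "(nat \<Rightarrow> 'n rpoly) \<Rightarrow> 'n expo set \<Rightarrow> nat \<Rightarrow> 'n expo \<Rightarrow> 'n expo \<Rightarrow> real" where
  "C_step g T j \<beta> \<gamma> = of_bool ((supp (constr g j) + {\<beta> + \<gamma>}) \<inter> T \<noteq> {})"

definition B_step ::
  "(nat \<Rightarrow> 'n::finite rpoly) \<Rightarrow> nat \<Rightarrow> 'n expo set \<Rightarrow> nat \<Rightarrow> 'n expo \<Rightarrow> 'n expo \<Rightarrow> real" where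
  "B_step g s T j = block_closure (idx g s j) (C_step g T j)"

primrec S_set ::
  "'n::finite rpoly \<Rightarrow> (nat \<Rightarrow> 'n rpoly) \<Rightarrow> nat \<Rightarrow> nat \<Rightarrow> nat \<Rightarrow> nat \<Rightarrow> 'n expo set" where
  "S_set f g m s 0 = (\<lambda>j. if j = 0 then supp_all f g m \<union> even_expos else {})"
| "S_set f g m s (Suc k) = (\<lambda>j.
     supp (constr g j) +
     {\<beta> + \<gamma> | \<beta> \<gamma>. \<beta> \<in> idx g s j \<and> \<gamma> \<in> idx g s j \<and>
        B_step g s (\<Union>i\<in>{0..m}. S_set f g m s k i) j \<beta> \<gamma> = 1})"

text \<open>Intended for \<open>k \<ge> 1\<close>; at \<open>k = 0\<close> the truncated subtraction yields the value for \<open>k = 1\<close>.\<close>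

definition B_mat ::
  "'n::finite rpoly \<Rightarrow> (nat \<Rightarrow> 'n rpoly) \<Rightarrow> nat \<Rightarrow> nat \<Rightarrow> nat \<Rightarrow> nat \<Rightarrow> 'n expo \<Rightarrow> 'n expo \<Rightarrow> real"
  where
  "B_mat f g m s k j = B_step g s (\<Union>i\<in>{0..m}. S_set f g m s (k - 1) i) j"

text \<open>
  The case \<open>j = 0\<close> is the constraint on the moment matrix, since \<open>g\<^sub>0 = 1\<close> and \<open>d\<^sub>0 = 0\<close>.
\<close>

definition feasible ::
  "'n::finite rpoly \<Rightarrow> (nat \<Rightarrow> 'n rpoly) \<Rightarrow> nat \<Rightarrow> nat \<Rightarrow> nat \<Rightarrow> ('n expo \<Rightarrow> real) set" where
  "feasible f g m k s =
     {y. (\<forall>j\<in>{0..m}. psd_mat (idx g s j)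
            (hadamard (B_mat f g m s k j) (localizing_mat (constr g j) y))) \<and>
         y 0 = 1}"

definition theta :: "'n::finite rpoly \<Rightarrow> (nat \<Rightarrow> 'n rpoly) \<Rightarrow> nat \<Rightarrow> nat \<Rightarrow> nat \<Rightarrow> ereal" where
  "theta f g m k s = (INF y\<in>feasible f g m k s. ereal (riesz y f))"

end

(*
  Passing from the order s to a larger order s' enlarges the index sets and the supports, hence the
  block patterns. Each block of the pattern at order s thus lies in a single block at order s', so
  the masked localizing matrix at order s is a direct sum of principal submatrices of the one at
  order s', and feasibility at s' implies feasibility at s.
*)

theory Submission
  imports Defs "HOL-Library.FuncSet"
begin

text \<open>The classes of \<open>r\<close> partition \<open>D\<close>, and for \<open>i\<close> in
  a class \<open>C\<close> the pair \<open>(i, j)\<close> lies in \<open>r\<close> exactly when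
  \<open>j\<close> lies in \<open>C\<close>. This splits a masked quadratic form into one form per
  block.\<close>

lemma quotient_sum_nested:
  fixes h :: "'a \<Rightarrow> 'a \<Rightarrow> real"
  assumes fin: "finite D" and eq: "equiv D r"
  shows "(\<Sum>i\<in>D. \<Sum>j\<in>D. of_bool ((i, j) \<in> r) * h i j) = (\<Sum>C\<in>D // r. \<Sum>i\<in>C. \<Sum>j\<in>C. h i j)"
proof -
  have sub: "r \<subseteq> D \<times> D"
    using eq by (rule equiv_type)
  have C_sub: "C \<subseteq> D" if "C \<in> D // r" for C
    using Union_quotient[OF eq] that by blast
  have "(\<Sum>i\<in>D. \<Sum>j\<in>D. of_bool ((i, j) \<in> r) * h i j)
      = (\<Sum>i\<in>\<Union>(D // r). \<Sum>j\<in>D. of_bool ((i, j) \<in> r) * h i j)"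
    by (simp add: Union_quotient[OF eq])
  also have "\<dots> = (\<Sum>C\<in>D // r. \<Sum>i\<in>C. \<Sum>j\<in>D. of_bool ((i, j) \<in> r) * h i j)"
  proof (subst sum.Union_disjoint)
    show "\<forall>C\<in>D // r. finite C"
      using C_sub finite_subset[OF _ fin] by blast
    show "\<forall>C\<in>D // r. \<forall>C'\<in>D // r. C \<noteq> C' \<longrightarrow> C \<inter> C' = {}"
      using quotient_disj[OF eq] by blast
  qed simp
  also have "\<dots> = (\<Sum>C\<in>D // r. \<Sum>i\<in>C. \<Sum>j\<in>C. h i j)"
  proof (rule sum.cong[OF refl], rule sum.cong[OF refl])
    fix C i assume C: "C \<in> D // r" and i: "i \<in> C"
    have "(i, j) \<in> r \<longleftrightarrow> j \<in> C" for j
      using quotient_eq_iff[OF eq C C i] in_quotient_imp_closed[OF eq C i] by auto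
    moreover have "D \<inter> C = C"
      using C_sub[OF C] by blast
    ultimately show "(\<Sum>j\<in>D. of_bool ((i, j) \<in> r) * h i j) = (\<Sum>j\<in>C. h i j)"
      using fin by (simp add: of_bool_def if_distrib[of "\<lambda>x. x * _"] sum.If_cases cong: if_cong)
  qed
  finally show ?thesis .
qed

text \<open>Extending \<open>v\<close> by zero from \<open>C\<close> to \<open>J\<close> turns the
  form of the principal submatrix into a value of the full form.\<close>

lemma psd_mat_principal_nonneg:
  assumes psd: "psd_mat J M" and fin: "finite J" and "C \<subseteq> J"
  shows "0 \<le> (\<Sum>i\<in>C. \<Sum>j\<in>C. v i * M i j * v j)"
proof -
  let ?w = "\<lambda>i. if i \<in> C then v i else 0"
  have "0 \<le> (\<Sum>i\<in>J. \<Sum>j\<in>J. ?w i * M i j * ?w j)"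
    using psd unfolding psd_mat_def by (elim conjE allE[of _ ?w])
  also have "\<dots> = (\<Sum>i\<in>C. \<Sum>j\<in>J. ?w i * M i j * ?w j)"
    using fin \<open>C \<subseteq> J\<close> by (intro sum.mono_neutral_right) auto
  also have "\<dots> = (\<Sum>i\<in>C. \<Sum>j\<in>C. ?w i * M i j * ?w j)"
    using fin \<open>C \<subseteq> J\<close> by (intro sum.cong refl sum.mono_neutral_right) auto
  also have "\<dots> = (\<Sum>i\<in>C. \<Sum>j\<in>C. v i * M i j * v j)"
    by (intro sum.cong refl) auto
  finally show ?thesis .
qed

text \<open>Symmetry and transitivity make \<open>r\<close> an equivalence on its field. For each
  class \<open>C\<close>, the square of \<open>C\<close> lies in \<open>r\<close> and hence in
  \<open>r'\<close>, so the \<open>r'\<close>-mask is constantly 1 there and the form of the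
  \<open>r\<close>-masked matrix is a sum of forms of principal submatrices of the
  \<open>r'\<close>-masked one.\<close>

lemma psd_mat_hadamard_refine:
  assumes fin: "finite J" and "I \<subseteq> J" and "r \<subseteq> I \<times> I" and "r \<subseteq> r'"
    and "sym r" and "trans r" and "sym r'"
    and psd: "psd_mat J (hadamard (\<lambda>i j. of_bool ((i, j) \<in> r')) M)"
  shows "psd_mat I (hadamard (\<lambda>i j. of_bool ((i, j) \<in> r)) M)"
proof -
  let ?A = "hadamard (\<lambda>i j. of_bool ((i, j) \<in> r)) M"
  let ?A' = "hadamard (\<lambda>i j. of_bool ((i, j) \<in> r')) M"
  \<comment> \<open>\<open>M\<close> itself need not be symmetric: the hypothesis controls only the
    entries that the \<open>r'\<close>-mask keeps.\<close>
  have M_sym: "M i j = M j i" if "(i, j) \<in> r" for i j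
  proof -
    have "(i, j) \<in> r'" "(j, i) \<in> r'" "i \<in> J" "j \<in> J"
      using that assms(2-4) \<open>sym r'\<close> by (auto dest: symD)
    then show ?thesis
      using psd by (fastforce simp: psd_mat_def hadamard_def)
  qed
  have "?A i j = ?A j i" for i j
    using M_sym[of i j] \<open>sym r\<close> by (auto simp: hadamard_def of_bool_def dest: symD)
  moreover have "0 \<le> (\<Sum>i\<in>I. \<Sum>j\<in>I. v i * ?A i j * v j)" for v
  proof -
    \<comment> \<open>\<open>r\<close> may fail to be reflexive on \<open>I\<close>; the indices
      outside \<open>D\<close> carry zero rows and columns and drop out of the sum.\<close>
    define D where "D = {i \<in> I. (i, i) \<in> r}"
    have r_D: "i \<in> D \<and> j \<in> D" if "(i, j) \<in> r" for i j
      using that \<open>sym r\<close> \<open>trans r\<close> \<open>r \<subseteq> I \<times> I\<close> unfolding D_def by (blast dest: symD transD)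
    have eq: "equiv D r"
      using r_D \<open>sym r\<close> \<open>trans r\<close> by (intro equivI refl_onI) (auto simp: D_def)
    have "D \<subseteq> I"
      by (auto simp: D_def)
    have fins: "finite I" "finite D"
      using finite_subset[OF \<open>I \<subseteq> J\<close> fin] by (auto simp: D_def)
    have "(\<Sum>i\<in>I. \<Sum>j\<in>I. v i * ?A i j * v j) = (\<Sum>i\<in>D. \<Sum>j\<in>I. v i * ?A i j * v j)"
      using fins \<open>D \<subseteq> I\<close> r_D
      by (intro sum.mono_neutral_right) (auto simp: hadamard_def intro!: sum.neutral)
    also have "\<dots> = (\<Sum>i\<in>D. \<Sum>j\<in>D. v i * ?A i j * v j)"
      using fins \<open>D \<subseteq> I\<close> r_D
      by (intro sum.cong refl sum.mono_neutral_right) (auto simp: hadamard_def)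
    \<comment> \<open>Masking by \<open>r\<close> after \<open>r'\<close> is the same as masking by
      \<open>r\<close> alone.\<close>
    also have "\<dots> = (\<Sum>i\<in>D. \<Sum>j\<in>D. of_bool ((i, j) \<in> r) * (v i * ?A' i j * v j))"
      using \<open>r \<subseteq> r'\<close> by (intro sum.cong refl) (auto simp: hadamard_def)
    also have "\<dots> = (\<Sum>C\<in>D // r. \<Sum>i\<in>C. \<Sum>j\<in>C. v i * ?A' i j * v j)"
      using fins(2) eq by (rule quotient_sum_nested)
    also have "\<dots> \<ge> 0"
    proof (rule sum_nonneg)
      fix C assume "C \<in> D // r"
      then have "C \<subseteq> J"
        using Union_quotient[OF eq] \<open>D \<subseteq> I\<close> \<open>I \<subseteq> J\<close> by blast
      with psd fin show "0 \<le> (\<Sum>i\<in>C. \<Sum>j\<in>C. v i * ?A' i j * v j)"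
        by (rule psd_mat_principal_nonneg)
    qed
    finally show ?thesis .
  qed
  ultimately show ?thesis
    by (simp add: psd_mat_def)
qed

text \<open>The degree bounds every coordinate, so \<open>lookup\<close> embeds the set into the
  finitely many functions with values at most \<open>t\<close>.\<close>

lemma finite_expos_upto: "finite (expos_upto t :: 'n::finite expo set)"
proof -
  have "Poly_Mapping.lookup \<alpha> i \<le> t" if "expo_deg \<alpha> \<le> t" for \<alpha> :: "'n expo" and i
    using member_le_sum[of i UNIV "Poly_Mapping.lookup \<alpha>"] that by (simp add: expo_deg_def)
  then have "Poly_Mapping.lookup ` (expos_upto t :: 'n expo set) \<subseteq> UNIV \<rightarrow>\<^sub>E {..t}"
    by (auto simp: expos_upto_def)
  then have "finite (Poly_Mapping.lookup ` (expos_upto t :: 'n expo set))"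
    by (rule finite_subset) (intro finite_PiE, auto)
  then show ?thesis
    by (rule finite_imageD) (simp add: inj_on_def poly_mapping_eqI)
qed

lemma idx_mono: "s \<le> s' \<Longrightarrow> idx g s j \<subseteq> idx g s' j"
  by (auto simp: idx_def expos_upto_def)

text \<open>The positions of the ones of \<open>B_step\<close>, kept as a relation so that
  inclusion, symmetry and transitivity can be stated directly.\<close>

definition blocks ::
  "(nat \<Rightarrow> 'n::finite rpoly) \<Rightarrow> nat \<Rightarrow> 'n expo set \<Rightarrow> nat \<Rightarrow> ('n expo \<times> 'n expo) set" where
  "blocks g s T j = {(\<beta>, \<gamma>). \<beta> \<in> idx g s j \<and> \<gamma> \<in> idx g s j \<and> C_step g T j \<beta> \<gamma> = 1}\<^sup>+"

lemma B_step_eq_blocks: "B_step g s T j = (\<lambda>\<beta> \<gamma>. of_bool ((\<beta>, \<gamma>) \<in> blocks g s T j))"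
  by (simp add: B_step_def block_closure_def blocks_def fun_eq_iff)

lemma blocks_subset: "blocks g s T j \<subseteq> idx g s j \<times> idx g s j"
  unfolding blocks_def by (rule trancl_subset_Sigma) auto

lemma sym_blocks: "sym (blocks g s T j)"
  unfolding blocks_def by (rule sym_trancl) (auto simp: sym_def C_step_def add.commute)

lemma trans_blocks: "trans (blocks g s T j)"
  by (simp add: blocks_def)

lemma blocks_mono:
  assumes "s \<le> s'" "T \<subseteq> T'"
  shows "blocks g s T j \<subseteq> blocks g s' T' j"
proof -
  have "C_step g T' j \<beta> \<gamma> = 1" if "C_step g T j \<beta> \<gamma> = 1" for \<beta> \<gamma>
    using that assms(2) by (auto simp: C_step_def)
  then show ?thesis
    using idx_mono[OF assms(1), of g j] unfolding blocks_def by (intro trancl_mono_subset) auto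
qed

text \<open>The initial sets do not depend on the order, and each round preserves inclusion. The
  induction keeps \<open>j\<close> arbitrary because a round uses the union over all
  indices.\<close>

lemma S_set_mono: "s \<le> s' \<Longrightarrow> S_set f g m s k j \<subseteq> S_set f g m s' k j"
proof (induction k arbitrary: j)
  case (Suc k)
  then have "(\<Union>i\<in>{0..m}. S_set f g m s k i) \<subseteq> (\<Union>i\<in>{0..m}. S_set f g m s' k i)"
    by blast
  from blocks_mono[OF Suc.prems this, of g j] idx_mono[OF Suc.prems, of g j]
  show ?case
    unfolding S_set.simps B_step_eq_blocks by (intro set_plus_mono2 order_refl) auto
qed simp

text \<open>The entries of \<open>localizing_mat\<close> do not depend on the order; only the index
  set and the mask do, so the same \<open>y\<close> serves at both orders.\<close>

lemma feasible_antimono: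
  assumes "s \<le> s'"
  shows "feasible f g m k s' \<subseteq> feasible f g m k s"
proof
  fix y assume y: "y \<in> feasible f g m k s'"
  have "(\<Union>i\<in>{0..m}. S_set f g m s (k - 1) i) \<subseteq> (\<Union>i\<in>{0..m}. S_set f g m s' (k - 1) i)"
    using S_set_mono[OF assms] by (intro UN_mono order_refl)
  note mono = blocks_mono[OF assms this]
  show "y \<in> feasible f g m k s"
    unfolding feasible_def mem_Collect_eq B_mat_def B_step_eq_blocks
  proof (intro conjI ballI)
    fix j assume "j \<in> {0..m}"
    with y have "psd_mat (idx g s' j) (hadamard
        (\<lambda>\<beta> \<gamma>. of_bool ((\<beta>, \<gamma>) \<in> blocks g s' (\<Union>i\<in>{0..m}. S_set f g m s' (k - 1) i) j))
        (localizing_mat (constr g j) y))"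
      unfolding feasible_def mem_Collect_eq B_mat_def B_step_eq_blocks by blast
    then show "psd_mat (idx g s j) (hadamard
        (\<lambda>\<beta> \<gamma>. of_bool ((\<beta>, \<gamma>) \<in> blocks g s (\<Union>i\<in>{0..m}. S_set f g m s (k - 1) i) j))
        (localizing_mat (constr g j) y))"
      \<comment> \<open>Resolving the semidefiniteness premise first fixes the larger index set and
        the larger relation, which do not occur in the goal.\<close>
      by (rule psd_mat_hadamard_refine[rotated -1])
        (simp_all add: idx_mono[OF assms] mono[simplified] blocks_subset sym_blocks trans_blocks,
          simp add: idx_def finite_expos_upto)
  qed (use y in \<open>simp add: feasible_def\<close>)
qed

theorem theorem5p2:
  fixes f :: "'n::finite rpoly"
    and g :: "nat \<Rightarrow> 'n rpoly"
    and m k :: nat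
  assumes "k \<ge> 1"
  shows "mono_on {min_order f g m..} (\<lambda>s. theta f g m k s)"
  \<comment> \<open>The objective is the same at every order, so the infimum over the smaller
    feasible set is at least as large; in \<open>ereal\<close> this covers empty feasible sets and
    unbounded objectives.\<close>
  unfolding theta_def by (intro mono_onI INF_superset_mono feasible_antimono order_refl)

end
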